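(* There exists a constant $t_0$ such that for all $t\ge t_0$, with $y=e^{t e^{-\gamma}}$, $$A(t) \le B(t) < e^{3\sqrt{y}}\, A\left(t-\frac{5e^\gamma}{\sqrt{y}}\right).$$
   Context: For real $t$, $A(t):= \lim_{N\to \infty}\frac{1}{N} |\{n\le N: \sigma(n)/n \ge t \}|$ and $B(t):= \lim_{N\to \infty}\frac{1}{N} |\{n\le N: n/\varphi(n) \ge t \}|$, where $n$ ranges over positive integers, $\sigma(n)$ is the sum of the positive divisors of $n$ and $\varphi$ is Euler's totient function. Both limits are known to exist for every $t$ and to be continuous functions of $t$. $\gamma$ is Euler's constant. *)

theory Defs
  imports
    "HOL-Analysis.Harmonic_Numbers"
    "HOL-Number_Theory.Totient"
begin

definition divisor_sum :: "nat \<Rightarrow> nat" where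
  "divisor_sum n = (\<Sum>d | d dvd n. d)"

text \<open>The asymptotic density of the positive integers satisfying \<open>P\<close>.
  As usual for \<^const>\<open>lim\<close>, the value is meaningful only when the limit exists.\<close>

definition natural_density :: "(nat \<Rightarrow> bool) \<Rightarrow> real" where
  "natural_density P = lim (\<lambda>N. real (card {n. 1 \<le> n \<and> n \<le> N \<and> P n}) / real N)"

definition A_density :: "real \<Rightarrow> real" where
  "A_density t = natural_density (\<lambda>n. real (divisor_sum n) / real n \<ge> t)"

definition B_density :: "real \<Rightarrow> real" where
  "B_density t = natural_density (\<lambda>n. real n / real (totient n) \<ge> t)"

end

theory Submission
  imports
    Defs
    "HOL-Analysis.Infinite_Products"
    "HOL-Real_Asymp.Real_Asymp"
begin

text \<open>Both \<open>ln (\<sigma>(n)/n)\<close> and \<open>ln (n/\<phi>(n))\<close> are additive, monotone under divisibility and injective on the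
  primes. Such an \<open>f\<close> is approximated by the periodic functions \<open>n \<mapsto> f (gcd n k!)\<close>, whose level sets
  have densities; these converge because values of \<open>f\<close> do not concentrate near any point.

  For the second inequality put \<open>x = \<surd>y\<close>. If \<open>n/\<phi>(n) \<ge> t\<close>, multiply \<open>n\<close> by the product \<open>m\<close> of the primes up to
  \<open>2 x\<close> and a logarithmic power of the product of the primes up to \<open>x powr (2/3)\<close>. Then
  \<open>\<sigma>(n m)/(n m) \<ge> (n/\<phi>(n)) (1 - E)\<close>, where \<open>E\<close> is essentially \<open>\<Sum> 1/p\<^sup>2\<close> over the primes \<open>p > 2 x\<close>. With
  Chebyshev's bound \<open>\<theta>(z) \<le> z ln 4\<close> one gets \<open>m \<le> exp ((2 ln 4 + o(1)) x)\<close> and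
  \<open>E \<le> (ln 4 + o(1)) / (x ln x)\<close>; since \<open>t = 2 exp \<gamma> ln x\<close>, the constants \<open>3 > 2 ln 4\<close> and \<open>5 > 2 ln 4\<close>
  suffice.\<close>

section \<open>Arithmetic of the two ratios and divergence of the prime reciprocals\<close>

definition abundancy :: "nat \<Rightarrow> real" where
  "abundancy n = real (divisor_sum n) / real n"

definition totient_ratio :: "nat \<Rightarrow> real" where
  "totient_ratio n = real n / real (totient n)"

lemma divisor_sum_mult_coprime:
  assumes "coprime m n"
  shows "divisor_sum (m * n) = divisor_sum m * divisor_sum n"
proof -
  have "divisor_sum m * divisor_sum n
      = (\<Sum>(a, b)\<in>{a. a dvd m} \<times> {b. b dvd n}. a * b)"
    unfolding divisor_sum_def sum_product sum.cartesian_product ..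
  also have "\<dots> = (\<Sum>d | d dvd m * n. d)"
  proof -
    have "bij_betw (\<lambda>p. fst p * snd p) ({a. a dvd m} \<times> {b. b dvd n}) {d. d dvd m * n}"
    proof (rule bij_betw_imageI)
      show "inj_on (\<lambda>p. fst p * snd p) ({a. a dvd m} \<times> {b. b dvd n})"
      proof (rule inj_onI, clarsimp)
        fix a b a' b' assume *: "a dvd m" "b dvd n" "a' dvd m" "b' dvd n" "a * b = a' * b'"
        have "coprime a b'" "coprime a' b"
          using * assms by (meson coprime_divisors)+
        with * have "a dvd a'" "a' dvd a" "b dvd b'" "b' dvd b"
          by (metis dvd_triv_left dvd_triv_right coprime_dvd_mult_left_iff
              coprime_dvd_mult_right_iff coprime_commute)+
        then show "a = a' \<and> b = b'" by (simp add: dvd_antisym)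
      qed
      show "(\<lambda>p. fst p * snd p) ` ({a. a dvd m} \<times> {b. b dvd n}) = {d. d dvd m * n}"
      proof (intro equalityI subsetI)
        fix d assume "d \<in> {d. d dvd m * n}"
        then obtain a b where "d = a * b" "a dvd m" "b dvd n" by (auto elim: dvd_productE)
        then show "d \<in> (\<lambda>p. fst p * snd p) ` ({a. a dvd m} \<times> {b. b dvd n})"
          by (intro image_eqI[of _ _ "(a, b)"]) auto
      qed (auto intro: mult_dvd_mono)
    qed
    from sum.reindex_bij_betw[OF this, of "\<lambda>d. d"] show ?thesis by (simp add: case_prod_beta)
  qed
  finally show ?thesis by (simp add: divisor_sum_def)
qed

lemma abundancy_mult_coprime:
  "coprime m n \<Longrightarrow> abundancy (m * n) = abundancy m * abundancy n"
  by (simp add: abundancy_def divisor_sum_mult_coprime)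

text \<open>The complementary divisor \<open>n div d\<close> turns \<open>d / n\<close> into
  \<open>1 / d\<close>. In this form, divisibility of arguments becomes inclusion of index
  sets.\<close>

lemma abundancy_eq_sum_inverse:
  assumes "n > 0"
  shows "abundancy n = (\<Sum>d | d dvd n. 1 / real d)"
proof -
  have "abundancy n = (\<Sum>d | d dvd n. real d / real n)"
    by (simp add: abundancy_def divisor_sum_def sum_divide_distrib)
  also have "\<dots> = (\<Sum>d | d dvd n. 1 / real d)"
    using assms
    by (intro sum.reindex_bij_witness[of _ "\<lambda>d. n div d" "\<lambda>d. n div d"])
       (auto simp: real_of_nat_div div_dvd_iff_mult elim: dvdE)
  finally show ?thesis .
qed

lemma abundancy_1 [simp]: "abundancy (Suc 0) = 1"
  by (simp add: abundancy_def divisor_sum_def)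

lemma abundancy_ge_1:
  assumes "n > 0"
  shows "abundancy n \<ge> 1"
proof -
  have "(\<Sum>d\<in>{1}. 1 / real d) \<le> (\<Sum>d | d dvd n. 1 / real d)"
    using assms by (intro sum_mono2) auto
  then show ?thesis using assms by (simp add: abundancy_eq_sum_inverse)
qed

lemma abundancy_dvd_mono:
  assumes "m dvd n" "n > 0"
  shows "abundancy m \<le> abundancy n"
proof -
  have "m > 0" using assms by (auto intro: Nat.gr0I)
  have "(\<Sum>d | d dvd m. 1 / real d) \<le> (\<Sum>d | d dvd n. 1 / real d)"
    using assms by (intro sum_mono2) (auto intro: dvd_trans)
  then show ?thesis using assms \<open>m > 0\<close> by (simp add: abundancy_eq_sum_inverse)
qed

text \<open>A geometric sum, arranged so that its limit \<open>p / (p - 1)\<close> for growing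
  \<open>k\<close> splits off; that limit is the factor of \<open>p\<close> in
  \<open>totient_ratio\<close>.\<close>

lemma abundancy_prime_power:
  assumes "prime p"
  shows "abundancy (p ^ k) = real p / (real p - 1) * (1 - 1 / real p ^ (k + 1))"
proof -
  have p: "p > 1" using assms prime_gt_1_nat by blast
  have "abundancy (p ^ k) = (\<Sum>d\<in>(\<lambda>i. p ^ i) ` {..k}. 1 / real d)"
    using assms p by (subst abundancy_eq_sum_inverse)
      (auto intro!: sum.cong simp: divides_primepow_nat image_iff)
  also have "\<dots> = (\<Sum>i\<le>k. (1 / real p) ^ i)"
    using p by (subst sum.reindex) (auto simp: inj_on_def power_one_over)
  also have "\<dots> = ((1 / real p) ^ (k + 1) - 1) / (1 / real p - 1)"
    using p by (subst geometric_sum[symmetric]) (auto simp: lessThan_Suc_atMost)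
  also have "\<dots> = real p / (real p - 1) * (1 - 1 / real p ^ (k + 1))"
    using p by (simp add: power_one_over divide_simps) (simp add: algebra_simps)
  finally show ?thesis .
qed

lemma abundancy_prod_prime_powers:
  assumes "finite S" "\<And>p. p \<in> S \<Longrightarrow> prime p"
  shows "abundancy (\<Prod>p\<in>S. p ^ e p) = (\<Prod>p\<in>S. abundancy (p ^ e p))"
  using assms
proof (induction rule: finite_induct)
  case (insert q S)
  have "coprime (q ^ e q) (\<Prod>p\<in>S. p ^ e p)"
    using insert.hyps insert.prems
    by (intro prod_coprime_right) (metis coprime_power_left_iff coprime_power_right_iff insertCI primes_coprime)
  then show ?case using insert by (simp add: abundancy_mult_coprime)
qed simp

lemma abundancy_eq_prod:
  assumes "n > 0"
  shows "abundancy n = (\<Prod>p\<in>prime_factors n. abundancy (p ^ multiplicity p n))"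
  using abundancy_prod_prime_powers[of "prime_factors n" "\<lambda>p. multiplicity p n"]
    prime_factorization_nat[OF assms] by auto

lemma totient_ratio_eq_prod:
  assumes "n > 0"
  shows "totient_ratio n = (\<Prod>p\<in>prime_factors n. real p / (real p - 1))"
proof -
  have "totient_ratio n = 1 / (\<Prod>p\<in>prime_factors n. 1 - 1 / real p)"
    using assms by (simp add: totient_ratio_def totient_formula2)
  also have "\<dots> = (\<Prod>p\<in>prime_factors n. 1 / (1 - 1 / real p))"
    by (simp add: prod_dividef)
  also have "\<dots> = (\<Prod>p\<in>prime_factors n. real p / (real p - 1))"
    by (intro prod.cong refl) (auto simp: field_simps dest!: in_prime_factors_imp_prime prime_gt_1_nat)
  finally show ?thesis .
qed

text \<open>This locates the gap between the ratios in the multiplicities: the correction factors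
  tend to 1 as the exponents grow, so multiplying \<open>n\<close> by extra prime powers can nearly
  close it.\<close>

lemma abundancy_eq_totient_ratio_times:
  assumes "n > 0"
  shows "abundancy n = totient_ratio n * (\<Prod>p\<in>prime_factors n. 1 - 1 / real p ^ (multiplicity p n + 1))"
  unfolding abundancy_eq_prod[OF assms] totient_ratio_eq_prod[OF assms] prod.distrib[symmetric]
  by (intro prod.cong refl abundancy_prime_power) (auto dest: in_prime_factors_imp_prime)

lemma totient_ratio_pos: "n > 0 \<Longrightarrow> totient_ratio n > 0"
  by (simp add: totient_ratio_def)

lemma abundancy_le_totient_ratio:
  assumes "n > 0"
  shows "abundancy n \<le> totient_ratio n"
proof -
  have "(\<Prod>p\<in>prime_factors n. 1 - 1 / real p ^ (multiplicity p n + 1)) \<le> 1"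
  proof (intro prod_le_1 conjI)
    fix p assume "p \<in> prime_factors n"
    then have "real p ^ (multiplicity p n + 1) \<ge> 1"
      using in_prime_factors_imp_prime prime_ge_1_nat by (intro one_le_power) force
    then show "0 \<le> 1 - 1 / real p ^ (multiplicity p n + 1)" "1 - 1 / real p ^ (multiplicity p n + 1) \<le> 1"
      by simp_all
  qed
  then show ?thesis
    using totient_ratio_pos[OF assms] by (simp add: abundancy_eq_totient_ratio_times[OF assms])
qed

text \<open>Every positive \<open>d \<le> n\<close> divides \<open>fact n\<close>, so the divergent
  harmonic series makes the abundancy unbounded.\<close>

lemma harm_le_abundancy_fact: "harm n \<le> abundancy (fact n)"
proof -
  have "(\<Sum>d = 1..n. 1 / real d) \<le> (\<Sum>d | d dvd (fact n :: nat). 1 / real d)"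
    by (intro sum_mono2) (auto intro: dvd_fact)
  then show ?thesis by (simp add: abundancy_eq_sum_inverse harm_def field_simps)
qed

lemma exists_abundancy_ge: "\<exists>n>0. abundancy n \<ge> T"
proof -
  have "eventually (\<lambda>n. harm n \<ge> T) sequentially"
    using harm_at_top by (auto simp: filterlim_at_top)
  then obtain n where "harm n \<ge> T" by (auto simp: eventually_sequentially)
  then show ?thesis
    using harm_le_abundancy_fact[of n] by (intro exI[of _ "fact n"]) auto
qed

lemma ln_totient_ratio:
  assumes "n > 0"
  shows "ln (totient_ratio n) = (\<Sum>p\<in>prime_factors n. ln (real p / (real p - 1)))"
  unfolding totient_ratio_eq_prod[OF assms]
  by (rule ln_prod) (auto dest!: in_prime_factors_imp_prime prime_gt_1_nat)

lemma ln_prime_ratio_le: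
  assumes "prime (p :: nat)"
  shows "ln (real p / (real p - 1)) \<le> 2 / real p"
proof -
  have p: "real p \<ge> 2" using prime_ge_2_nat[OF assms] by simp
  have "ln (real p / (real p - 1)) \<le> real p / (real p - 1) - 1"
    using p by (intro ln_le_minus_one) auto
  also have "\<dots> \<le> 2 / real p" using p by (simp add: field_simps)
  finally show ?thesis .
qed

text \<open>Unbounded abundancy forces unbounded \<open>totient_ratio\<close>, whose logarithm is at
  most twice the sum of \<open>1 / p\<close> over the prime factors.\<close>

lemma exists_primes_sum_inverse_gt:
  "\<exists>Q. finite Q \<and> (\<forall>p\<in>Q. prime (p :: nat) \<and> p \<ge> a) \<and> (\<Sum>p\<in>Q. 1 / real p) > C"
proof -
  \<comment> \<open>The added sum pays for discarding the prime factors below \<open>a\<close>; a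
    term at 0 has value 0.\<close>
  define C' where "C' = C + (\<Sum>p<a. 1 / real p)"
  obtain n where n: "n > 0" "abundancy n \<ge> exp (2 * C') + 1" using exists_abundancy_ge by blast
  have "totient_ratio n > exp (2 * C')" using abundancy_le_totient_ratio[OF n(1)] n by simp
  then have "2 * C' < ln (totient_ratio n)"
    by (metis exp_gt_zero less_trans ln_exp ln_less_cancel_iff)
  also have "\<dots> \<le> (\<Sum>p\<in>prime_factors n. 2 / real p)"
    unfolding ln_totient_ratio[OF n(1)]
    by (intro sum_mono ln_prime_ratio_le) (auto dest: in_prime_factors_imp_prime)
  also have "\<dots> = 2 * (\<Sum>p\<in>prime_factors n. 1 / real p)" by (simp add: sum_distrib_left)
  finally have "C' < (\<Sum>p\<in>prime_factors n. 1 / real p)" by simp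
  also have "\<dots> \<le> (\<Sum>p\<in>(prime_factors n - {..<a}) \<union> {..<a}. 1 / real p)"
    by (intro sum_mono2) auto
  also have "\<dots> = (\<Sum>p\<in>prime_factors n - {..<a}. 1 / real p) + (\<Sum>p<a. 1 / real p)"
    by (subst sum.union_disjoint) auto
  finally show ?thesis
    by (intro exI[of _ "prime_factors n - {..<a}"]) (auto simp: C'_def dest: in_prime_factors_imp_prime)
qed

subsection \<open>Existence of the densities\<close>

definition count_upto :: "(nat \<Rightarrow> bool) \<Rightarrow> nat \<Rightarrow> nat" where
  "count_upto P N = card {n. 1 \<le> n \<and> n \<le> N \<and> P n}"

lemma finite_count_upto [simp]: "finite {n. 1 \<le> n \<and> n \<le> (N :: nat) \<and> P n}"
  by (rule finite_subset[of _ "{..N}"]) auto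

lemma count_upto_le: "count_upto P N \<le> N"
proof -
  have "count_upto P N \<le> card {1..N}"
    unfolding count_upto_def by (intro card_mono) auto
  then show ?thesis by simp
qed

lemma count_upto_mono:
  assumes "\<And>n. 1 \<le> n \<Longrightarrow> P n \<Longrightarrow> Q n"
  shows "count_upto P N \<le> count_upto Q N"
  unfolding count_upto_def using assms by (intro card_mono) auto

lemma count_upto_disj_le:
  "count_upto (\<lambda>n. P n \<or> Q n) N \<le> count_upto P N + count_upto Q N"
proof -
  have "count_upto (\<lambda>n. P n \<or> Q n) N
      = card ({n. 1 \<le> n \<and> n \<le> N \<and> P n} \<union> {n. 1 \<le> n \<and> n \<le> N \<and> Q n})"
    unfolding count_upto_def by (rule arg_cong[of _ _ card]) auto
  then show ?thesis by (simp add: count_upto_def card_Un_le)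
qed

lemma count_upto_scale_le:
  assumes "a > 0" "\<And>n. 1 \<le> n \<Longrightarrow> P n \<Longrightarrow> Q (n * a)"
  shows "count_upto P N \<le> count_upto Q (N * a)"
  unfolding count_upto_def
  using assms by (intro card_inj_on_le[of "\<lambda>n. n * a"]) (auto simp: inj_on_def)

lemma count_upto_add_period:
  assumes "\<And>n. P (n + M) \<longleftrightarrow> P n"
  shows "count_upto P (M + N) = count_upto P M + count_upto P N"
proof -
  have eq: "{n. 1 \<le> n \<and> n \<le> M + N \<and> P n}
      = {n. 1 \<le> n \<and> n \<le> M \<and> P n} \<union> (\<lambda>n. n + M) ` {n. 1 \<le> n \<and> n \<le> N \<and> P n}"
    (is "?L = ?A \<union> ?B")
  proof (intro equalityI subsetI)
    fix x assume x: "x \<in> ?L"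
    show "x \<in> ?A \<union> ?B"
    proof (cases "x \<le> M")
      case False
      then have "x = (x - M) + M" "P (x - M)" using x assms[of "x - M"] by auto
      then show ?thesis using False x by (intro UnI2 image_eqI[of _ _ "x - M"]) auto
    qed (use x in auto)
  qed (use assms in auto)
  show ?thesis
    unfolding count_upto_def eq by (subst card_Un_disjoint) (auto simp: card_image)
qed

lemma count_upto_periodic:
  assumes "\<And>n. P (n + M) \<longleftrightarrow> P n"
  shows "count_upto P (j * M + r) = j * count_upto P M + count_upto P r"
  by (induction j) (auto simp: count_upto_add_period[of P M, OF assms] add.assoc)

lemma count_upto_multiples:
  assumes "p > 0" "p dvd M"
  shows "count_upto (\<lambda>n. p dvd n) M = M div p"
proof -
  obtain j where M: "M = j * p" using assms(2) by (metis dvdE mult.commute)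
  have "count_upto (\<lambda>n. p dvd n) p = card {p}"
    unfolding count_upto_def using assms(1) by (intro arg_cong[of _ _ card]) (auto dest: dvd_imp_le)
  then show ?thesis
    using count_upto_periodic[of "\<lambda>n. p dvd n" p j 0] assms(1) M by (simp add: count_upto_def)
qed

text \<open>Cut \<open>N = j * M + r\<close> into \<open>j\<close> full periods and a remainder
  \<open>r < M\<close>: full periods match the limit exactly, and the remainder costs at most
  \<open>M / N\<close>.\<close>

lemma periodic_count_upto_LIMSEQ:
  assumes "\<And>n. P (n + M) \<longleftrightarrow> P n" "M > 0"
  shows "(\<lambda>N. real (count_upto P N) / real N) \<longlonglongrightarrow> real (count_upto P M) / real M"
proof (rule LIM_zero_cancel)
  define c where "c = real (count_upto P M) / real M"
  have "norm (c - real (count_upto P N) / real N) \<le> real M / real N" if "N > 0" for N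
  proof -
    define j r where "j = N div M" and "r = N mod M"
    have N: "N = j * M + r" by (simp add: j_def r_def)
    have r: "real r \<le> real M" using assms(2) by (simp add: r_def less_imp_le)
    have "c * real N - real (count_upto P N) = c * real r - real (count_upto P r)"
      unfolding N count_upto_periodic[of P M, OF assms(1)] using assms(2) by (simp add: c_def field_simps)
    moreover have "0 \<le> c" "c \<le> 1" using count_upto_le[of P M] assms(2) by (auto simp: c_def)
    then have "0 \<le> c * real r" "c * real r \<le> real r"
      by (auto intro: mult_left_le_one_le)
    moreover have "real (count_upto P r) \<le> real r" using count_upto_le by simp
    ultimately have "\<bar>c * real N - real (count_upto P N)\<bar> \<le> real M" using r by linarith
    then have "\<bar>c * real N - real (count_upto P N)\<bar> / real N \<le> real M / real N"
      by (rule divide_right_mono) simp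
    moreover have "c - real (count_upto P N) / real N = (c * real N - real (count_upto P N)) / real N"
      using that by (simp add: field_simps)
    ultimately show ?thesis by simp
  qed
  then have "eventually (\<lambda>N. norm (c - real (count_upto P N) / real N) \<le> real M / real N) sequentially"
    by (auto intro!: eventually_sequentiallyI[of 1])
  moreover have "(\<lambda>N. real M / real N) \<longlonglongrightarrow> 0" by real_asymp
  ultimately show "(\<lambda>N. real (count_upto P N) / real N - real (count_upto P M) / real M) \<longlonglongrightarrow> 0"
    unfolding c_def norm_minus_commute[of "_ / real M"] by (rule Lim_null_comparison)
qed

section \<open>Additive functions: tails, anti-concentration, convergence of densities\<close>

lemma sum_inverse_squares_le:
  assumes "k \<ge> 1"
  shows "(\<Sum>d\<in>{k<..N}. 1 / (real d)\<^sup>2) \<le> 1 / real k"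
proof (cases "N \<ge> k")
  case True
  \<comment> \<open>Subtracting \<open>1 / N\<close> strengthens the claim so that the induction
    telescopes.\<close>
  have "(\<Sum>d\<in>{k<..N}. 1 / (real d)\<^sup>2) \<le> 1 / real k - 1 / real N"
    using True
  proof (induction N rule: dec_induct)
    case (step N)
    have "1 / (real (Suc N))\<^sup>2 \<le> 1 / real N - 1 / real (Suc N)"
    proof -
      have "1 / (real (Suc N))\<^sup>2 \<le> 1 / (real N * real (Suc N))"
        using step.hyps assms by (intro divide_left_mono) (auto simp: power2_eq_square)
      also have "\<dots> = 1 / real N - 1 / real (Suc N)"
        using step.hyps assms by (simp add: field_simps)
      finally show ?thesis .
    qed
    moreover have "{k<..Suc N} = insert (Suc N) {k<..N}" using step.hyps by auto
    ultimately show ?case using step.IH by simp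
  qed simp
  also have "\<dots> \<le> 1 / real k" by simp
  finally show ?thesis .
qed simp

text \<open>What the density argument needs from the two logarithms. \<open>inj\<close> separates
  translated windows of values; \<open>tail\<close> bounds what the periodic truncation
  \<open>f (gcd n (fact k))\<close> misses by a quantity of mean O(1/k). Its factor 2 comes from
  \<open>ln_prime_ratio_le\<close>.\<close>

locale additive_function =
  fixes f :: "nat \<Rightarrow> real"
  assumes add: "\<And>m n. coprime m n \<Longrightarrow> m > 0 \<Longrightarrow> n > 0 \<Longrightarrow> f (m * n) = f m + f n"
    and mono: "\<And>m n. m dvd n \<Longrightarrow> n > 0 \<Longrightarrow> f m \<le> f n"
    and inj: "inj_on f {p. prime p}"
    and tail: "\<And>n k. n > 0 \<Longrightarrow> f n - f (gcd n (fact k)) \<le> 2 * (\<Sum>d | d dvd n \<and> k < d. 1 / real d)"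
begin

text \<open>Markov's inequality: sum the bound \<open>tail\<close> over \<open>n \<le> N\<close> and
  exchange the sums. Each \<open>d > k\<close> divides at most \<open>N / d\<close> of the
  \<open>n\<close>, hence contributes at most \<open>N / d^2\<close>.\<close>

lemma count_tail_le:
  assumes "\<epsilon> > 0" "k \<ge> 1"
  shows "real (count_upto (\<lambda>n. f n - f (gcd n (fact k)) \<ge> \<epsilon>) N) \<le> 2 / (\<epsilon> * real k) * real N"
proof -
  let ?S = "{n. 1 \<le> n \<and> n \<le> N \<and> f n - f (gcd n (fact k)) \<ge> \<epsilon>}"
  have "\<epsilon> * real (card ?S) = (\<Sum>n\<in>?S. \<epsilon>)" by simp
  also have "\<dots> \<le> (\<Sum>n\<in>?S. 2 * (\<Sum>d | d dvd n \<and> k < d. 1 / real d))"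
  proof (rule sum_mono)
    fix n assume "n \<in> ?S"
    then show "\<epsilon> \<le> 2 * (\<Sum>d | d dvd n \<and> k < d. 1 / real d)" using tail[of n k] by simp
  qed
  also have "\<dots> \<le> (\<Sum>n\<in>{1..N}. 2 * (\<Sum>d | d dvd n \<and> k < d. 1 / real d))"
    by (intro sum_mono2) (auto intro!: sum_nonneg)
  also have "\<dots> = 2 * (\<Sum>n\<in>{1..N}. \<Sum>d | d \<in> {k<..N} \<and> d dvd n. 1 / real d)"
    unfolding sum_distrib_left
    by (intro sum.cong refl) (auto dest: dvd_imp_le)
  also have "(\<Sum>n\<in>{1..N}. \<Sum>d | d \<in> {k<..N} \<and> d dvd n. 1 / real d)
      = (\<Sum>d\<in>{k<..N}. \<Sum>n | n \<in> {1..N} \<and> d dvd n. 1 / real d)"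
    by (rule sum.swap_restrict) auto
  also have "\<dots> \<le> (\<Sum>d\<in>{k<..N}. real N * (1 / (real d)\<^sup>2))"
  proof (rule sum_mono)
    fix d assume "d \<in> {k<..N}"
    then have d: "d > 0" by auto
    have "card {n \<in> {1..N}. d dvd n} \<le> card ((\<lambda>i. i * d) ` {1..N div d})"
    proof (rule card_mono)
      show "{n \<in> {1..N}. d dvd n} \<subseteq> (\<lambda>i. i * d) ` {1..N div d}"
      proof
        fix n assume "n \<in> {n \<in> {1..N}. d dvd n}"
        then show "n \<in> (\<lambda>i. i * d) ` {1..N div d}"
          using d by (intro image_eqI[of _ _ "n div d"])
            (auto simp: div_le_mono dest: dvd_imp_le simp: Suc_le_eq div_greater_zero_iff)
      qed
    qed simp
    also have "\<dots> \<le> card {1..N div d}" by (rule card_image_le) simp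
    finally have "real (card {n \<in> {1..N}. d dvd n}) \<le> real (N div d)" by simp
    also have "\<dots> \<le> real N / real d"
      using d by (simp add: pos_le_divide_eq flip: of_nat_mult)
    finally show "(\<Sum>n | n \<in> {1..N} \<and> d dvd n. 1 / real d) \<le> real N * (1 / (real d)\<^sup>2)"
      using d by (simp add: field_simps power2_eq_square)
  qed
  also have "\<dots> \<le> real N * (1 / real k)"
    unfolding sum_distrib_left[symmetric] by (intro mult_left_mono sum_inverse_squares_le assms) simp
  finally show ?thesis
    using assms by (simp add: count_upto_def field_simps)
qed

text \<open>\<open>fact k\<close> may contain high powers of \<open>p\<close>, but
  \<open>p * n\<close> contains \<open>p\<close> only once, so truncation keeps exactly one factor
  \<open>p\<close>.\<close>

lemma truncation_mult_prime:
  assumes "prime p" "p \<le> k" "\<not> p dvd n" "n > 0"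
  shows "f (gcd (p * n) (fact k)) = f p + f (gcd n (fact k))"
proof -
  have p: "p dvd fact k" using assms by (auto simp: prime_dvd_fact_iff)
  have cop: "coprime p n" using assms prime_imp_coprime by blast
  then have cop': "coprime p (gcd n (fact k))"
    by (meson coprime_divisors dvd_refl gcd_dvd1)
  have "gcd (p * n) (fact k) = p * gcd n (fact k)"
  proof (rule dvd_antisym)
    show "p * gcd n (fact k) dvd gcd (p * n) (fact k)"
      using p cop' by (auto intro: divides_mult)
    have "gcd (p * n) (fact k) dvd gcd (p * n) (p * fact k)"
      by (intro gcd_mono) auto
    then show "gcd (p * n) (fact k) dvd p * gcd n (fact k)"
      by (simp add: gcd_mult_left)
  qed
  then show ?thesis using add[OF cop'] prime_gt_0_nat[OF assms(1)] assms(4) by simp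
qed

text \<open>Multiplication by a prime \<open>p \<nmid> n\<close> translates a window of values by \<open>f p\<close> at the cost of a
  factor \<open>p\<close> in density. The translated windows are disjoint and \<open>\<Sum> 1 / p\<close> diverges, so that a window
  of positive density would lead to total density greater than one.\<close>

lemma window_count_le:
  assumes "m > 0"
  shows "\<exists>\<epsilon>>0. \<exists>K. \<forall>k\<ge>K.
    real (count_upto (\<lambda>n. \<bar>f (gcd n (fact k)) - s\<bar> \<le> \<epsilon>) (fact k)) \<le> m * fact k"
proof -
  \<comment> \<open>Primes \<open>p \<ge> a\<close> satisfy \<open>1 / p \<le> m / 2\<close>, so
    removing the multiples of \<open>p\<close> from a set of density above \<open>m\<close> leaves
    at least half of \<open>m\<close>.\<close>
  obtain a :: nat where a: "2 / m \<le> real a" "a > 0"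
    by (metis assms divide_pos_pos gr0I less_le_not_le of_nat_0 real_nat_ceiling_ge zero_less_numeral)
  obtain Q where Q: "finite Q" "\<And>p. p \<in> Q \<Longrightarrow> prime (p :: nat)" "\<And>p. p \<in> Q \<Longrightarrow> p \<ge> a"
    "(\<Sum>p\<in>Q. 1 / real p) > 2 / m"
    using exists_primes_sum_inverse_gt[of a "2 / m"] by blast
  \<comment> \<open>The gaps between the values of \<open>f\<close> on \<open>Q\<close>; the element
    1 keeps \<open>Min D\<close> meaningful when there are none.\<close>
  define D where "D = insert 1 ((\<lambda>(p, q). \<bar>f p - f q\<bar>) ` {(p, q). p \<in> Q \<and> q \<in> Q \<and> p \<noteq> q})"
  have "finite {(p, q). p \<in> Q \<and> q \<in> Q \<and> p \<noteq> q}"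
    by (rule finite_subset[of _ "Q \<times> Q"]) (use Q in auto)
  then have D: "finite D" "D \<noteq> {}" by (auto simp: D_def)
  have "f p \<noteq> f q" if "p \<in> Q" "q \<in> Q" "p \<noteq> q" for p q
    using that Q(2) inj by (auto simp: inj_on_def)
  then have "Min D > 0" using D by (subst Min_gr_iff) (auto simp: D_def)
  \<comment> \<open>Windows of radius \<open>\<epsilon>\<close> translated by \<open>f p\<close> and
    \<open>f q\<close> can meet only if the translations differ by at most
    \<open>2 * \<epsilon>\<close>, which is less than \<open>Min D\<close>.\<close>
  define \<epsilon> where "\<epsilon> = Min D / 3"
  have \<epsilon>: "\<epsilon> > 0" using \<open>Min D > 0\<close> by (simp add: \<epsilon>_def)
  have sep: "p = q" if "p \<in> Q" "q \<in> Q" "\<bar>f p - f q\<bar> \<le> 2 * \<epsilon>" for p q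
  proof (rule ccontr)
    assume "p \<noteq> q"
    then have "Min D \<le> \<bar>f p - f q\<bar>" using that D by (intro Min_le) (auto simp: D_def)
    then show False using that \<epsilon> by (simp add: \<epsilon>_def)
  qed
  \<comment> \<open>A crude upper bound for all elements of \<open>Q\<close>, which therefore divide
    \<open>fact k\<close> for \<open>k \<ge> K\<close>.\<close>
  define K where "K = (\<Sum>p\<in>Q. p)"
  have "real (count_upto (\<lambda>n. \<bar>f (gcd n (fact k)) - s\<bar> \<le> \<epsilon>) (fact k)) \<le> m * fact k" if "k \<ge> K" for k
  proof (rule ccontr)
    define M :: nat where "M = fact k"
    define E where "E n \<longleftrightarrow> \<bar>f (gcd n M) - s\<bar> \<le> \<epsilon>" for n
    assume "\<not> ?thesis"
    then have cE: "real (count_upto E M) > m * real M" by (simp add: E_def[abs_def] M_def)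
    have M: "M > 0" by (simp add: M_def)
    have pk: "p \<le> k" if "p \<in> Q" for p
      using member_le_sum[of p Q "\<lambda>p. p"] that Q(1) \<open>k \<ge> K\<close> by (simp add: K_def)
    have pM: "p dvd M" if "p \<in> Q" for p
      using pk[OF that] Q(2)[OF that] by (simp add: M_def prime_dvd_fact_iff)
    define Ep where "Ep p n \<longleftrightarrow> E n \<and> \<not> p dvd n" for p n
    \<comment> \<open>The range of \<open>n\<close> is a whole number of periods \<open>M\<close>,
      so the count is exact, and it ends where \<open>p * n\<close> reaches
      \<open>M * M\<close>.\<close>
    define T where "T p = (\<lambda>n. p * n) ` {n. 1 \<le> n \<and> n \<le> (M div p) * M \<and> Ep p n}" for p
    have cardT: "real (card (T p)) \<ge> real M ^ 2 * (m / 2) * (1 / real p)" if p: "p \<in> Q" for p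
    proof -
      have p0: "p > 0" using Q(2)[OF p] prime_gt_0_nat by blast
      have per: "Ep p (n + M) \<longleftrightarrow> Ep p n" for n
        using pM[OF p] by (auto simp: Ep_def E_def dvd_add_left_iff)
      have "card (T p) = count_upto (Ep p) ((M div p) * M)"
        using p0 by (simp add: T_def count_upto_def card_image inj_on_def)
      also have "\<dots> = (M div p) * count_upto (Ep p) M"
        using count_upto_periodic[of "Ep p" M "M div p" 0, OF per] by (simp add: count_upto_def)
      finally have 1: "card (T p) = (M div p) * count_upto (Ep p) M" .
      have "count_upto E M \<le> count_upto (\<lambda>n. Ep p n \<or> p dvd n) M"
        by (rule count_upto_mono) (auto simp: Ep_def)
      also have "\<dots> \<le> count_upto (Ep p) M + M div p"
        using count_upto_disj_le[of "Ep p" "\<lambda>n. p dvd n" M] count_upto_multiples[OF p0 pM[OF p]] by simp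
      finally have "real (count_upto E M) \<le> real (count_upto (Ep p) M) + real (M div p)" by linarith
      moreover have Mp: "real (M div p) = real M * (1 / real p)" using pM[OF p] by (simp add: real_of_nat_div)
      moreover have "1 / real p \<le> m / 2"
      proof -
        have "2 / m \<le> real p" using a(1) Q(3)[OF p] by linarith
        then show ?thesis using assms p0 by (simp add: field_simps)
      qed
      then have "real M * (1 / real p) \<le> real M * (m / 2)" by (rule mult_left_mono) simp
      moreover have "m * real M = real M * (m / 2) + real M * (m / 2)" by simp
      ultimately have "real (count_upto (Ep p) M) \<ge> real M * (m / 2)"
        using cE by linarith
      then have "(real M * (1 / real p)) * real (count_upto (Ep p) M) \<ge> (real M * (1 / real p)) * (real M * (m / 2))"
        by (rule mult_left_mono) simp
      then show ?thesis unfolding 1 of_nat_mult Mp by (simp add: power2_eq_square field_simps)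
    qed
    have disj: "T p \<inter> T q = {}" if "p \<in> Q" "q \<in> Q" "p \<noteq> q" for p q
    proof (rule ccontr)
      have val: "\<bar>f (gcd x M) - f r - s\<bar> \<le> \<epsilon>" if "x \<in> T r" "r \<in> Q" for x r
      proof -
        obtain n where n: "x = r * n" "1 \<le> n" "Ep r n" using \<open>x \<in> T r\<close> by (auto simp: T_def)
        then have "f (gcd x M) = f r + f (gcd n M)"
          unfolding M_def n(1) using Q(2)[OF \<open>r \<in> Q\<close>] pk[OF \<open>r \<in> Q\<close>]
          by (intro truncation_mult_prime) (auto simp: Ep_def)
        then show ?thesis using n(3) by (simp add: Ep_def E_def)
      qed
      assume "T p \<inter> T q \<noteq> {}"
      then obtain x where "x \<in> T p" "x \<in> T q" by blast
      then have "\<bar>f p - f q\<bar> \<le> 2 * \<epsilon>" using val[of x p] val[of x q] that by linarith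
      then show False using sep that by blast
    qed
    have fin: "finite (T p)" for p by (simp add: T_def)
    \<comment> \<open>The disjoint sets \<open>T p\<close> all lie in \<open>{1..M * M}\<close>, yet
      their sizes would add up to more than \<open>M ^ 2\<close>.\<close>
    have "real M ^ 2 < real M ^ 2 * (m / 2) * (\<Sum>p\<in>Q. 1 / real p)"
      using Q(4) assms M by (simp add: field_simps)
    also have "\<dots> \<le> (\<Sum>p\<in>Q. real (card (T p)))"
      unfolding sum_distrib_left by (intro sum_mono cardT)
    also have "\<dots> = real (card (\<Union>p\<in>Q. T p))"
      using Q(1) fin disj by (subst card_UN_disjoint) auto
    also have "\<dots> \<le> real (card {1..M * M})"
    proof (intro of_nat_mono card_mono)
      show "(\<Union>p\<in>Q. T p) \<subseteq> {1..M * M}"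
      proof
        fix x assume "x \<in> (\<Union>p\<in>Q. T p)"
        then obtain p n where *: "p \<in> Q" "x = p * n" "1 \<le> n" "n \<le> (M div p) * M" by (auto simp: T_def)
        have "p * n \<le> p * ((M div p) * M)" using *(4) by simp
        also have "\<dots> = M * M" using pM[OF *(1)] by (simp add: mult.assoc[symmetric])
        finally show "x \<in> {1..M * M}" using * Q(2)[OF *(1)] prime_gt_0_nat[of p] by auto
      qed
    qed simp
    also have "\<dots> = real M ^ 2" by (simp add: power2_eq_square)
    finally show False by simp
  qed
  then show ?thesis using \<epsilon> by blast
qed

text \<open>Truncation only lowers \<open>f\<close>. So \<open>f n \<ge> s\<close> follows from the
  truncated condition, and it implies that the truncation is at least \<open>s\<close>, or lies
  within \<open>\<epsilon>\<close> of \<open>s\<close>, or misses at least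
  \<open>\<epsilon>\<close>. The first two conditions are periodic and the last two are rare, so the
  frequencies are Cauchy.\<close>

lemma convergent_density:
  "convergent (\<lambda>N. real (count_upto (\<lambda>n. f n \<ge> s) N) / real N)"
proof -
  define a where "a N = real (count_upto (\<lambda>n. f n \<ge> s) N) / real N" for N
  have "Cauchy a"
  proof (rule metric_CauchyI)
    fix e :: real assume "e > 0"
    \<comment> \<open>The frequencies end up in an interval of length \<open>5 * \<eta>\<close>,
      shorter than \<open>e\<close>.\<close>
    define \<eta> where "\<eta> = e / 6"
    have \<eta>: "\<eta> > 0" using \<open>e > 0\<close> by (simp add: \<eta>_def)
    obtain \<epsilon> K where \<epsilon>: "\<epsilon> > 0" and K: "\<And>k. k \<ge> K \<Longrightarrow>
        real (count_upto (\<lambda>n. \<bar>f (gcd n (fact k)) - s\<bar> \<le> \<epsilon>) (fact k)) \<le> \<eta> * fact k"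
      using window_count_le[OF \<eta>, of s] by blast
    \<comment> \<open>Large enough both for the window bound and for the tail bound
      \<open>2 / (\<epsilon> * k) \<le> \<eta>\<close>.\<close>
    define k where "k = max (max K 1) (nat \<lceil>2 / (\<epsilon> * \<eta>)\<rceil>)"
    have k: "k \<ge> K" "k \<ge> 1" by (auto simp: k_def)
    have "2 / (\<epsilon> * \<eta>) \<le> real k" by (simp add: k_def) linarith
    then have k2: "2 / (\<epsilon> * real k) \<le> \<eta>" using \<epsilon> \<eta> k by (simp add: field_simps)
    define M :: nat where "M = fact k"
    have M: "M > 0" by (simp add: M_def)
    define P where "P n \<longleftrightarrow> f (gcd n M) \<ge> s" for n
    define W where "W n \<longleftrightarrow> \<bar>f (gcd n M) - s\<bar> \<le> \<epsilon>" for n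
    define c where "c = real (count_upto P M) / real M"
    have "(\<lambda>N. real (count_upto P N) / real N) \<longlonglongrightarrow> c"
      unfolding c_def by (intro periodic_count_upto_LIMSEQ M) (simp add: P_def)
    then have evP: "eventually (\<lambda>N. \<bar>real (count_upto P N) / real N - c\<bar> < \<eta>) sequentially"
      using \<eta> by (auto dest!: tendstoD simp: dist_real_def)
    have "(\<lambda>N. real (count_upto W N) / real N) \<longlonglongrightarrow> real (count_upto W M) / real M"
      by (intro periodic_count_upto_LIMSEQ M) (simp add: W_def)
    moreover have "real (count_upto W M) / real M < 2 * \<eta>"
    proof -
      have "real (count_upto W M) \<le> \<eta> * real M" using K[OF k(1)] by (simp add: W_def[abs_def] M_def)
      then have "real (count_upto W M) / real M \<le> \<eta>" using M by (simp add: field_simps)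
      then show ?thesis using \<eta> by simp
    qed
    ultimately have evW: "eventually (\<lambda>N. real (count_upto W N) / real N < 2 * \<eta>) sequentially"
      by (rule order_tendstoD)
    \<comment> \<open>The upper margin is \<open>\<eta>\<close> for the deviation of
      \<open>P\<close> from \<open>c\<close>, \<open>2 * \<eta>\<close> for the window and
      \<open>\<eta>\<close> for the tail.\<close>
    have "eventually (\<lambda>N. a N > c - \<eta> \<and> a N < c + 4 * \<eta>) sequentially"
      using evP evW eventually_gt_at_top[of 0]
    proof eventually_elim
      case (elim N)
      have "count_upto P N \<le> count_upto (\<lambda>n. f n \<ge> s) N"
      proof (rule count_upto_mono)
        fix n :: nat assume "1 \<le> n" "P n"
        then show "f n \<ge> s" using mono[of "gcd n M" n] by (simp add: P_def)
      qed
      then have "real (count_upto P N) / real N \<le> a N" unfolding a_def by (intro divide_right_mono) auto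
      moreover have "real (count_upto (\<lambda>n. f n \<ge> s) N)
          \<le> real (count_upto P N) + real (count_upto W N) + \<eta> * real N"
      proof -
        let ?R = "\<lambda>n. f n - f (gcd n (fact k)) \<ge> \<epsilon>"
        have "count_upto (\<lambda>n. f n \<ge> s) N \<le> count_upto (\<lambda>n. (P n \<or> W n) \<or> ?R n) N"
          by (rule count_upto_mono) (auto simp: P_def W_def M_def)
        also have "\<dots> \<le> count_upto P N + count_upto W N + count_upto ?R N"
          using count_upto_disj_le[of "\<lambda>n. P n \<or> W n" ?R N] count_upto_disj_le[of P W N] by linarith
        finally have "real (count_upto (\<lambda>n. f n \<ge> s) N)
            \<le> real (count_upto P N) + real (count_upto W N) + real (count_upto ?R N)" by linarith
        moreover have "real (count_upto ?R N) \<le> \<eta> * real N"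
          using count_tail_le[OF \<epsilon> k(2), of N] mult_right_mono[OF k2, of "real N"] by linarith
        ultimately show ?thesis by linarith
      qed
      then have "a N \<le> real (count_upto P N) / real N + real (count_upto W N) / real N + \<eta>"
        using elim(3) by (simp add: a_def field_simps)
      ultimately show ?case using elim(1,2) by linarith
    qed
    then obtain N0 where N0: "\<And>N. N \<ge> N0 \<Longrightarrow> a N > c - \<eta> \<and> a N < c + 4 * \<eta>"
      by (auto simp: eventually_sequentially)
    show "\<exists>N0. \<forall>m\<ge>N0. \<forall>n\<ge>N0. dist (a m) (a n) < e"
    proof (intro exI[of _ N0] allI impI)
      fix m n assume "m \<ge> N0" "n \<ge> N0"
      then show "dist (a m) (a n) < e"
        using N0[of m] N0[of n] \<eta> by (simp add: dist_real_def \<eta>_def abs_less_iff)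
    qed
  qed
  then show ?thesis unfolding a_def[abs_def] by (simp add: Cauchy_convergent_iff)
qed

end

section \<open>The logarithms of both ratios as additive functions\<close>

interpretation abundancy: additive_function "\<lambda>n. ln (abundancy n)"
proof
  have pos: "abundancy n > 0" if "n > 0" for n
    using abundancy_ge_1[OF that] by linarith
  fix m n k :: nat
  show "ln (abundancy (m * n)) = ln (abundancy m) + ln (abundancy n)"
    if "coprime m n" "m > 0" "n > 0"
    using that pos[of m] pos[of n] by (simp add: abundancy_mult_coprime ln_mult)
  show "ln (abundancy m) \<le> ln (abundancy n)" if "m dvd n" "n > 0"
  proof -
    have "m > 0" using that by (auto intro: Nat.gr0I)
    then show ?thesis using that pos[of m] abundancy_dvd_mono[OF that] by simp
  qed
  have "abundancy p = 1 + 1 / real p" if "prime p" for p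
  proof -
    have "abundancy p = real p / (real p - 1) * (1 - 1 / real p ^ 2)"
      using abundancy_prime_power[OF that, of 1] by (simp add: power2_eq_square)
    also have "\<dots> = 1 + 1 / real p"
      using prime_gt_1_nat[OF that] by (simp add: divide_simps power2_eq_square) (simp add: algebra_simps)
    finally show ?thesis .
  qed
  then show "inj_on (\<lambda>n. ln (abundancy n)) {p. prime p}"
    by (auto simp: inj_on_def add_pos_nonneg ln_inj_iff dest: prime_gt_0_nat)
  show "ln (abundancy n) - ln (abundancy (gcd n (fact k))) \<le> 2 * (\<Sum>d | d dvd n \<and> k < d. 1 / real d)"
    if n: "n > 0"
  proof -
    define g where "g = gcd n (fact k)"
    have g: "g > 0" "g dvd n" using n by (auto simp: g_def)
    \<comment> \<open>Each positive \<open>d \<le> k\<close> divides \<open>fact k\<close>, so the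
      divisors lost in passing from \<open>n\<close> to \<open>g\<close> all exceed
      \<open>k\<close>.\<close>
    have big: "d > k" if "d dvd n" "\<not> d dvd g" for d
    proof (rule ccontr)
      assume "\<not> d > k"
      moreover have "d > 0" using that n by (auto intro: Nat.gr0I)
      ultimately have "d dvd fact k" by (intro dvd_fact) auto
      then show False using that by (simp add: g_def)
    qed
    have "ln (abundancy n) - ln (abundancy g) = ln (abundancy n / abundancy g)"
      using pos[OF n] pos[OF g(1)] by (simp add: ln_div)
    also have "\<dots> \<le> abundancy n / abundancy g - 1"
      using pos n g by (intro ln_le_minus_one) simp
    also have "\<dots> = (abundancy n - abundancy g) / abundancy g"
      using pos[OF g(1)] by (simp add: field_simps)
    also have "\<dots> \<le> (abundancy n - abundancy g) / 1"
      using abundancy_ge_1[OF g(1)] abundancy_dvd_mono[OF g(2) n] by (intro divide_left_mono) auto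
    also have "\<dots> = (\<Sum>d\<in>{d. d dvd n} - {d. d dvd g}. 1 / real d)"
      using n g by (subst sum_diff) (auto simp: abundancy_eq_sum_inverse intro: dvd_trans)
    also have "\<dots> \<le> (\<Sum>d | d dvd n \<and> k < d. 1 / real d)"
      using n big by (intro sum_mono2) auto
    also have "\<dots> \<le> 2 * \<dots>" by (simp add: sum_nonneg)
    finally show ?thesis by (simp add: g_def)
  qed
qed

interpretation totient_ratio: additive_function "\<lambda>n. ln (totient_ratio n)"
proof
  have ln_ge_0: "ln (real p / (real p - 1)) \<ge> 0" if "prime p" for p :: nat
    using prime_gt_1_nat[OF that] by (intro ln_ge_zero) (auto simp: field_simps)
  fix m n k :: nat
  show "ln (totient_ratio (m * n)) = ln (totient_ratio m) + ln (totient_ratio n)"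
    if "coprime m n" "m > 0" "n > 0"
    using that by (simp add: totient_ratio_def totient_mult_coprime ln_mult ln_div)
  show "ln (totient_ratio m) \<le> ln (totient_ratio n)" if "m dvd n" "n > 0"
  proof -
    have "m > 0" using that by (auto intro: Nat.gr0I)
    then show ?thesis
      using that unfolding ln_totient_ratio[OF \<open>m > 0\<close>] ln_totient_ratio[OF \<open>n > 0\<close>]
      by (intro sum_mono2 ln_ge_0 dvd_prime_factors) (auto dest: in_prime_factors_imp_prime)
  qed
  have ratio: "totient_ratio p = 1 + 1 / (real p - 1)" if "prime p" for p
    using prime_gt_1_nat[OF that] by (simp add: totient_ratio_def totient_prime[OF that] field_simps)
  show "inj_on (\<lambda>n. ln (totient_ratio n)) {p. prime p}"
  proof (rule inj_onI)
    fix p q :: nat assume "p \<in> {p. prime p}" "q \<in> {p. prime p}"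
      and eq: "ln (totient_ratio p) = ln (totient_ratio q)"
    then have pq: "prime p" "prime q" by auto
    then have "totient_ratio p = totient_ratio q"
      using eq totient_ratio_pos[of p] totient_ratio_pos[of q] by (simp add: prime_gt_0_nat)
    then show "p = q" using pq by (simp add: ratio)
  qed
  show "ln (totient_ratio n) - ln (totient_ratio (gcd n (fact k))) \<le> 2 * (\<Sum>d | d dvd n \<and> k < d. 1 / real d)"
    if n: "n > 0"
  proof -
    define g where "g = gcd n (fact k)"
    have g: "g > 0" "g dvd n" using n by (auto simp: g_def)
    have sub: "prime_factors g \<subseteq> prime_factors n" using n g by (intro dvd_prime_factors) auto
    have "ln (totient_ratio n) - ln (totient_ratio g)
        = (\<Sum>p\<in>prime_factors n - prime_factors g. ln (real p / (real p - 1)))"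
      unfolding ln_totient_ratio[OF n] ln_totient_ratio[OF g(1)] using sub by (subst sum_diff) auto
    also have "\<dots> \<le> (\<Sum>p\<in>prime_factors n - prime_factors g. 2 * (1 / real p))"
      by (intro sum_mono) (use ln_prime_ratio_le in auto)
    also have "\<dots> \<le> (\<Sum>d | d dvd n \<and> k < d. 2 * (1 / real d))"
    proof (rule sum_mono2)
      \<comment> \<open>A prime factor of \<open>n\<close> missing from \<open>g\<close> does not
        divide \<open>fact k\<close>, hence exceeds \<open>k\<close>.\<close>
      show "prime_factors n - prime_factors g \<subseteq> {d. d dvd n \<and> k < d}"
        using n g by (auto simp: prime_factors_dvd g_def prime_dvd_fact_iff)
    qed (use n in auto)
    finally show ?thesis by (simp add: g_def sum_distrib_left)
  qed
qed

subsection \<open>Primorials and sums over primes\<close>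

definition primorial :: "nat \<Rightarrow> nat" where
  "primorial n = (\<Prod>p | prime p \<and> p \<le> n. p)"

lemma finite_primes_le [simp]: "finite {p :: nat. prime p \<and> p \<le> n}"
  by (rule finite_subset[of _ "{..n}"]) auto

lemma primorial_pos: "primorial n > 0"
  unfolding primorial_def by (intro prod_pos) (auto dest: prime_gt_0_nat)

lemma prime_dvd_primorial: "prime p \<Longrightarrow> p \<le> n \<Longrightarrow> p dvd primorial n"
  unfolding primorial_def by (rule dvd_prodI) auto

lemma prod_primes_dvd:
  fixes x :: nat
  assumes "finite S" "\<And>p. p \<in> S \<Longrightarrow> prime p" "\<And>p. p \<in> S \<Longrightarrow> p dvd x"
  shows "(\<Prod>p\<in>S. p) dvd x"
  using assms
proof (induction rule: finite_induct)
  case (insert q S)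
  have "coprime q (\<Prod>p\<in>S. p)"
    using insert.hyps insert.prems by (intro prod_coprime_right) (metis insertCI primes_coprime)
  then show ?case using insert by (auto intro: divides_mult)
qed simp

text \<open>Erdos' argument: even \<open>n > 2\<close> adds no prime, and for
  \<open>n = 2 * m + 1\<close> the primes in \<open>(m + 1, n]\<close> all divide
  \<open>n choose m\<close>, which is at most \<open>4 ^ m\<close>.\<close>

lemma primorial_le: "primorial n \<le> 4 ^ n"
proof (induction n rule: less_induct)
  case (less n)
  consider "n \<le> 1" | "n = 2" | "n > 2" "even n" | "n > 2" "odd n" by linarith
  then show ?case
  proof cases
    case 1
    then have "{p. prime p \<and> p \<le> n} = {}" by (auto dest!: prime_ge_2_nat)
    then have "primorial n = 1" unfolding primorial_def by (simp only: prod.empty)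
    then show ?thesis by simp
  next
    case 2
    then have "{p. prime p \<and> p \<le> n} = {2}" by (auto dest: prime_ge_2_nat)
    then show ?thesis using 2 by (simp add: primorial_def)
  next
    case 3
    have "p \<le> n \<longleftrightarrow> p \<le> n - 1" if "prime p" for p
      using 3 that prime_odd_nat[of n] by (cases "p = n") auto
    then have "{p. prime p \<and> p \<le> n} = {p. prime p \<and> p \<le> n - 1}" by auto
    then have "primorial n = primorial (n - 1)" by (simp add: primorial_def)
    also have "\<dots> \<le> 4 ^ (n - 1)" using 3 by (intro less.IH) auto
    also have "\<dots> \<le> 4 ^ n" by (rule power_increasing) auto
    finally show ?thesis .
  next
    case 4
    then obtain m where n: "n = 2 * m + 1" by (auto elim: oddE)
    have m: "m > 0" using 4 n by auto
    have "(\<Prod>p | prime p \<and> m + 1 < p \<and> p \<le> n. p) dvd n choose m"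
    proof (rule prod_primes_dvd)
      fix p assume p: "p \<in> {p. prime p \<and> m + 1 < p \<and> p \<le> n}"
      have "fact m * fact (n - m) * (n choose m) = fact n"
        using n by (intro binomial_fact_lemma) simp
      moreover have "p dvd fact n" using p by (simp add: prime_dvd_fact_iff)
      ultimately have "p dvd fact m * fact (n - m) * (n choose m)" by simp
      moreover have "\<not> p dvd fact m" "\<not> p dvd fact (n - m)"
        using p n by (simp_all add: prime_dvd_fact_iff del: fact_Suc)
      ultimately show "p dvd n choose m" using p by (simp add: prime_dvd_mult_iff)
    qed (use finite_subset[OF _ finite_primes_le[of n]] in auto)
    moreover have "n choose m > 0" using n by (intro zero_less_binomial) auto
    ultimately have 1: "(\<Prod>p | prime p \<and> m + 1 < p \<and> p \<le> n. p) \<le> n choose m"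
      by (rule dvd_imp_le)
    \<comment> \<open>The two equal central coefficients both occur in the row sum
      \<open>2 ^ (2 * m + 1)\<close>.\<close>
    have "2 * (n choose m) = (\<Sum>i\<in>{m, m + 1}. n choose i)"
      using binomial_symmetric[of m n] n by simp
    also have "\<dots> \<le> (\<Sum>i\<le>n. n choose i)" using n by (intro sum_mono2) auto
    also have "\<dots> = 2 * 4 ^ m" by (simp only: choose_row_sum n) (simp add: power_mult)
    finally have 2: "n choose m \<le> 4 ^ m" by simp
    have "{p. prime p \<and> p \<le> n} = {p. prime p \<and> p \<le> m + 1} \<union> {p. prime p \<and> m + 1 < p \<and> p \<le> n}"
      using n by auto
    then have "primorial n = primorial (m + 1) * (\<Prod>p | prime p \<and> m + 1 < p \<and> p \<le> n. p)"
      unfolding primorial_def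
      by (simp only:) (rule prod.union_disjoint, use finite_subset[OF _ finite_primes_le[of n]] in auto)
    also have "\<dots> \<le> 4 ^ (m + 1) * 4 ^ m"
      using 1 2 n m by (intro mult_le_mono less.IH) auto
    also have "\<dots> = 4 ^ n" by (simp add: n power_add[symmetric] mult_2)
    finally show ?thesis .
  qed
qed

lemma sum_ln_primes_le: "(\<Sum>p | prime p \<and> p \<le> n. ln (real p)) \<le> ln 4 * real n"
proof -
  have "(\<Sum>p | prime p \<and> p \<le> n. ln (real p)) = ln (real (primorial n))"
    unfolding primorial_def of_nat_prod by (rule ln_prod[symmetric]) (auto dest: prime_gt_0_nat)
  also have "\<dots> \<le> ln (4 ^ n)"
    using primorial_le[of n] primorial_pos[of n] by (simp flip: of_nat_le_iff)
  also have "\<dots> = ln 4 * real n" by (simp add: ln_realpow)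
  finally show ?thesis .
qed

text \<open>Partial summation: the linear bound on the partial sums is played against the decrements
  of \<open>1 / n^2\<close>, and the result telescopes.\<close>

lemma sum_over_squares_le:
  fixes c :: "nat \<Rightarrow> real"
  assumes nonneg: "\<And>n. c n \<ge> 0" and bound: "\<And>n. (\<Sum>i\<le>n. c i) \<le> \<kappa> * real n"
  shows "(\<Sum>n\<in>{w<..M}. c n / (real n)\<^sup>2) \<le> 2 * \<kappa> / (real w + 1)"
proof (cases "w \<le> M")
  case True
  define S where "S n = (\<Sum>i\<le>n. c i)" for n
  have \<kappa>: "\<kappa> \<ge> 0" using bound[of 1] nonneg[of 0] nonneg[of 1] by simp
  have S0: "S n \<ge> 0" for n unfolding S_def by (intro sum_nonneg nonneg)
  \<comment> \<open>The boundary term carries the weight of the next index \<open>M + 1\<close>, so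
    that the new summand merges with it into \<open>S (Suc M)\<close>.\<close>
  have "(\<Sum>n\<in>{w<..M}. c n / (real n)\<^sup>2)
      \<le> S M / (real M + 1)\<^sup>2 + \<kappa> * (2 / (real w + 1) - 2 / (real M + 1))"
    using True
  proof (induction M rule: dec_induct)
    case base
    then show ?case using S0 by simp
  next
    case (step M)
    define x where "x = real M + 1"
    have x: "x > 0" by (simp add: x_def)
    have "{w<..Suc M} = insert (Suc M) {w<..M}" using step.hyps by auto
    then have "(\<Sum>n\<in>{w<..Suc M}. c n / (real n)\<^sup>2)
        = c (Suc M) / x\<^sup>2 + (\<Sum>n\<in>{w<..M}. c n / (real n)\<^sup>2)"
      by (simp add: x_def add.commute)
    also have "\<dots> \<le> c (Suc M) / x\<^sup>2 + (S M / x\<^sup>2 + \<kappa> * (2 / (real w + 1) - 2 / x))"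
      using step.IH by (simp add: x_def)
    also have "\<dots> = S (Suc M) / x\<^sup>2 + \<kappa> * (2 / (real w + 1) - 2 / x)"
      by (simp add: S_def add_divide_distrib)
    also have "S (Suc M) / x\<^sup>2 = S (Suc M) / (x + 1)\<^sup>2 + S (Suc M) * (1 / x\<^sup>2 - 1 / (x + 1)\<^sup>2)"
      by (simp add: algebra_simps)
    also have "S (Suc M) * (1 / x\<^sup>2 - 1 / (x + 1)\<^sup>2) \<le> (\<kappa> * x) * (1 / x\<^sup>2 - 1 / (x + 1)\<^sup>2)"
      using bound[of "Suc M"] x
      by (intro mult_right_mono) (auto simp: S_def x_def add.commute intro!: divide_left_mono power_mono)
    also have "(\<kappa> * x) * (1 / x\<^sup>2 - 1 / (x + 1)\<^sup>2) \<le> \<kappa> * (2 / x - 2 / (x + 1))"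
    proof -
      have "x * (1 / x\<^sup>2 - 1 / (x + 1)\<^sup>2) = (2 * x + 1) / (x * (x + 1)\<^sup>2)"
        using x by (simp add: divide_simps power2_eq_square) (simp add: algebra_simps)
      also have "\<dots> \<le> (2 * (x + 1)) / (x * (x + 1)\<^sup>2)" using x by (intro divide_right_mono) auto
      also have "\<dots> = 2 / x - 2 / (x + 1)"
        using x by (simp add: divide_simps power2_eq_square)
      finally show ?thesis using \<kappa> by (simp add: mult.assoc mult_left_mono)
    qed
    finally have "(\<Sum>n\<in>{w<..Suc M}. c n / (real n)\<^sup>2)
        \<le> S (Suc M) / (x + 1)\<^sup>2 + \<kappa> * (2 / (real w + 1) - 2 / (x + 1))"
      by (simp add: right_diff_distrib)
    then show ?case by (simp add: x_def add.commute)
  qed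
  also have "S M / (real M + 1)\<^sup>2 \<le> \<kappa> * (real M + 1) / (real M + 1)\<^sup>2"
    using bound[of M] \<kappa> by (intro divide_right_mono) (auto simp: S_def algebra_simps)
  also have "\<dots> = \<kappa> / (real M + 1)" by (simp add: power2_eq_square)
  finally have "(\<Sum>n\<in>{w<..M}. c n / (real n)\<^sup>2)
      \<le> \<kappa> / (real M + 1) + \<kappa> * (2 / (real w + 1) - 2 / (real M + 1))" by simp
  also have "\<dots> = 2 * \<kappa> / (real w + 1) - \<kappa> / (real M + 1)" by (simp add: algebra_simps)
  also have "\<dots> \<le> 2 * \<kappa> / (real w + 1)" using \<kappa> by simp
  finally show ?thesis .
next
  case False
  have "\<kappa> \<ge> 0" using bound[of 1] nonneg[of 0] nonneg[of 1] by simp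
  then show ?thesis using False by simp
qed

text \<open>For primes \<open>p > w\<close> the weight \<open>ln p / ln (w + 1)\<close> is at least
  1. Inserting it reduces the claim to partial summation with Chebyshev's bound.\<close>

lemma sum_prime_inverse_squares_le:
  assumes "w \<ge> 1"
  shows "(\<Sum>p | prime p \<and> w < p \<and> p \<le> M. 1 / (real p)\<^sup>2) \<le> 2 * ln 4 / ((real w + 1) * ln (real w + 1))"
proof -
  define c where "c n = (if prime n then ln (real n) else 0)" for n :: nat
  have sum_c: "(\<Sum>i\<in>A. c i * g i) = (\<Sum>p | prime p \<and> p \<in> A. ln (real p) * g p)"
    if "finite A" for A and g :: "nat \<Rightarrow> real"
    using that by (intro sum.mono_neutral_cong_right) (auto simp: c_def)
  have "(\<Sum>i\<le>n. c i) \<le> ln 4 * real n" for n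
    using sum_c[of "{..n}" "\<lambda>_. 1"] sum_ln_primes_le[of n] by simp
  moreover have "c n \<ge> 0" for n by (auto simp: c_def dest: prime_ge_1_nat)
  ultimately have *: "(\<Sum>n\<in>{w<..M}. c n / (real n)\<^sup>2) \<le> 2 * ln 4 / (real w + 1)"
    by (rule sum_over_squares_le[rotated])
  have l: "ln (real w + 1) > 0" using assms by simp
  have "(\<Sum>p | prime p \<and> w < p \<and> p \<le> M. 1 / (real p)\<^sup>2)
      \<le> (\<Sum>p | prime p \<and> w < p \<and> p \<le> M. ln (real p) * (1 / (real p)\<^sup>2) / ln (real w + 1))"
  proof (rule sum_mono)
    fix p assume "p \<in> {p. prime p \<and> w < p \<and> p \<le> M}"
    then have "ln (real w + 1) \<le> ln (real p)" by (subst ln_le_cancel_iff) auto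
    then have "1 * (1 / (real p)\<^sup>2) \<le> ln (real p) / ln (real w + 1) * (1 / (real p)\<^sup>2)"
      using l by (intro mult_right_mono) (auto simp: le_divide_eq)
    then show "1 / (real p)\<^sup>2 \<le> ln (real p) * (1 / (real p)\<^sup>2) / ln (real w + 1)"
      by (simp add: mult.commute)
  qed
  also have "\<dots> = (\<Sum>n\<in>{w<..M}. c n / (real n)\<^sup>2) / ln (real w + 1)"
    using sum_c[of "{w<..M}" "\<lambda>p. 1 / (real p)\<^sup>2"] by (simp add: sum_divide_distrib)
  also have "\<dots> \<le> 2 * ln 4 / (real w + 1) / ln (real w + 1)"
    using * l by (intro divide_right_mono) auto
  finally show ?thesis by simp
qed

text \<open>A prime \<open>p \<le> w\<close> that does not divide \<open>n\<close> only increases the left-hand side, so the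
  factors \<open>p\<close> of \<open>primorial w\<close> need to be accounted for only if \<open>p\<close> then divides
  \<open>n * primorial w\<close> at least twice.\<close>

lemma abundancy_mult_primorial_ge:
  assumes n: "n > 0" and v: "v \<ge> 1" and vw: "v \<le> w"
  shows "abundancy (n * (primorial w * primorial v ^ b))
    \<ge> totient_ratio n * (1 - (1 / 2 ^ (b + 1) + 1 / (real v)\<^sup>2 + 2 * ln 4 / ((real w + 1) * ln (real w + 1))))"
proof -
  define N where "N = n * (primorial w * primorial v ^ b)"
  \<comment> \<open>The exponent of \<open>p\<close> guaranteed by the multiplier; a prime factor of
    \<open>n\<close> thus has multiplicity at least \<open>a p + 1\<close> in
    \<open>N\<close>.\<close>
  define a where "a p = (if p \<le> v then b + 1 else if p \<le> w then 1 else 0)" for p :: nat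
  have N: "N > 0" using n by (simp add: N_def primorial_pos)
  have sub: "prime_factors n \<subseteq> prime_factors N" using N by (intro dvd_prime_factors) (auto simp: N_def)
  have P: "prime p" "p dvd n" if "p \<in> prime_factors n" for p using that by auto
  have mult: "p ^ (a p + 1) dvd p ^ multiplicity p N" if "p \<in> prime_factors n" for p
  proof -
    have "p ^ a p dvd primorial w * primorial v ^ b"
      using P[OF that] vw prime_dvd_primorial[of p v] prime_dvd_primorial[of p w]
      by (auto simp: a_def intro!: mult_dvd_mono dvd_power_same)
    then have "p ^ (a p + 1) dvd N"
      using P[OF that] unfolding N_def by (simp add: mult_dvd_mono)
    then have "a p + 1 \<le> multiplicity p N"
      using N P[OF that] by (intro multiplicity_geI) (auto simp: prime_gt_1_nat)
    then show ?thesis by (rule le_imp_power_dvd)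
  qed
  have "totient_ratio n * (1 - (\<Sum>p\<in>prime_factors n. 1 / real p ^ (a p + 2)))
      \<le> totient_ratio n * (\<Prod>p\<in>prime_factors n. 1 - 1 / real p ^ (a p + 2))"
  proof (intro mult_left_mono Weierstrass_prod_ineq)
    fix p assume "p \<in> prime_factors n"
    then have "real p ^ (a p + 2) \<ge> 1" using P prime_ge_1_nat by (intro one_le_power) force
    then show "1 / real p ^ (a p + 2) \<in> {0..1}" by simp
  qed (use totient_ratio_pos[OF n] in auto)
  also have "\<dots> = (\<Prod>p\<in>prime_factors n. abundancy (p ^ (a p + 1)))"
    unfolding totient_ratio_eq_prod[OF n] prod.distrib[symmetric]
    by (intro prod.cong refl, subst abundancy_prime_power) (auto dest: in_prime_factors_imp_prime)
  also have "\<dots> \<le> (\<Prod>p\<in>prime_factors n. abundancy (p ^ multiplicity p N))"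
  proof (intro prod_mono conjI)
    fix p assume p: "p \<in> prime_factors n"
    then have "p > 0" using P prime_gt_0_nat by blast
    show "0 \<le> abundancy (p ^ (a p + 1))" by (simp add: abundancy_def)
    show "abundancy (p ^ (a p + 1)) \<le> abundancy (p ^ multiplicity p N)"
      using mult[OF p] \<open>p > 0\<close> by (intro abundancy_dvd_mono) auto
  qed
  also have "\<dots> \<le> (\<Prod>p\<in>prime_factors N. abundancy (p ^ multiplicity p N))"
  proof (rule prod_mono2)
    have ge1: "1 \<le> abundancy (p ^ multiplicity p N)" if "p \<in> prime_factors N" for p
      using that prime_gt_0_nat[of p] by (intro abundancy_ge_1) auto
    show "1 \<le> abundancy (p ^ multiplicity p N)" if "p \<in> prime_factors N - prime_factors n" for p
      using ge1 that by blast
    show "0 \<le> abundancy (p ^ multiplicity p N)" if "p \<in> prime_factors n" for p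
      using ge1[of p] that sub by force
  qed (use sub in auto)
  also have "\<dots> = abundancy N" by (rule abundancy_eq_prod[OF N, symmetric])
  finally have main: "totient_ratio n * (1 - (\<Sum>p\<in>prime_factors n. 1 / real p ^ (a p + 2))) \<le> abundancy N" .
  \<comment> \<open>The exponent \<open>a p + 2\<close> is \<open>b + 3\<close>, 3 or 2 on the three
    ranges, giving the three error terms. Only beyond \<open>w\<close> does the sum have to be
    restricted to primes.\<close>
  have "(\<Sum>p\<in>prime_factors n. 1 / real p ^ (a p + 2))
      \<le> (\<Sum>p\<in>{1<..v} \<union> {v<..w} \<union> {p. prime p \<and> w < p \<and> p \<le> n}. 1 / real p ^ (a p + 2))"
  proof (rule sum_mono2)
    show "prime_factors n \<subseteq> {1<..v} \<union> {v<..w} \<union> {p. prime p \<and> w < p \<and> p \<le> n}"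
    proof
      fix p assume p: "p \<in> prime_factors n"
      have "1 < p" "p \<le> n" using P[OF p] n by (auto dest: prime_gt_1_nat dvd_imp_le)
      then show "p \<in> {1<..v} \<union> {v<..w} \<union> {p. prime p \<and> w < p \<and> p \<le> n}"
        using P(1)[OF p] by auto
    qed
  qed auto
  also have "\<dots> = (\<Sum>p\<in>{1<..v}. 1 / real p ^ (a p + 2)) + (\<Sum>p\<in>{v<..w}. 1 / real p ^ (a p + 2))
      + (\<Sum>p | prime p \<and> w < p \<and> p \<le> n. 1 / real p ^ (a p + 2))"
    using vw by (subst sum.union_disjoint; (subst sum.union_disjoint)?) auto
  also have "(\<Sum>p\<in>{1<..v}. 1 / real p ^ (a p + 2)) \<le> (\<Sum>p\<in>{1<..v}. 1 / 2 ^ (b + 1) * (1 / (real p)\<^sup>2))"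
  proof (rule sum_mono)
    fix p assume p: "p \<in> {1<..v}"
    have "real p ^ (a p + 2) = real p ^ (b + 1) * (real p)\<^sup>2"
      using p by (simp add: a_def power2_eq_square)
    moreover have "2 ^ (b + 1) * (real p)\<^sup>2 \<le> real p ^ (b + 1) * (real p)\<^sup>2"
      using p by (intro mult_right_mono power_mono) auto
    ultimately have "1 / real p ^ (a p + 2) \<le> 1 / (2 ^ (b + 1) * (real p)\<^sup>2)"
      using p by (intro divide_left_mono) auto
    then show "1 / real p ^ (a p + 2) \<le> 1 / 2 ^ (b + 1) * (1 / (real p)\<^sup>2)" by simp
  qed
  also have "\<dots> \<le> 1 / 2 ^ (b + 1) * (1 / real 1)"
    unfolding sum_distrib_left[symmetric] by (intro mult_left_mono sum_inverse_squares_le) auto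
  also have "(\<Sum>p\<in>{v<..w}. 1 / real p ^ (a p + 2)) \<le> (\<Sum>p\<in>{v<..w}. 1 / real v * (1 / (real p)\<^sup>2))"
  proof (rule sum_mono)
    fix p assume p: "p \<in> {v<..w}"
    then have "real p ^ (a p + 2) = real p * (real p)\<^sup>2" by (simp add: a_def power2_eq_square)
    moreover have "real v * (real p)\<^sup>2 \<le> real p * (real p)\<^sup>2"
      using p by (intro mult_right_mono) auto
    ultimately have "1 / real p ^ (a p + 2) \<le> 1 / (real v * (real p)\<^sup>2)"
      using p v by (intro divide_left_mono) auto
    then show "1 / real p ^ (a p + 2) \<le> 1 / real v * (1 / (real p)\<^sup>2)" by simp
  qed
  also have "\<dots> \<le> 1 / real v * (1 / real v)"
    unfolding sum_distrib_left[symmetric] by (intro mult_left_mono sum_inverse_squares_le v) auto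
  also have "(\<Sum>p | prime p \<and> w < p \<and> p \<le> n. 1 / real p ^ (a p + 2))
      = (\<Sum>p | prime p \<and> w < p \<and> p \<le> n. 1 / (real p)\<^sup>2)"
    using vw by (intro sum.cong) (auto simp: a_def power2_eq_square)
  also have "\<dots> \<le> 2 * ln 4 / ((real w + 1) * ln (real w + 1))"
    using v vw by (intro sum_prime_inverse_squares_le) auto
  finally have "(\<Sum>p\<in>prime_factors n. 1 / real p ^ (a p + 2))
      \<le> 1 / 2 ^ (b + 1) + 1 / (real v)\<^sup>2 + 2 * ln 4 / ((real w + 1) * ln (real w + 1))"
    by (simp add: power2_eq_square)
  then show ?thesis
    using main totient_ratio_pos[OF n] unfolding N_def
    by (meson diff_left_mono le_less mult_left_mono order_trans)
qed

subsection \<open>Comparison of the densities\<close>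

text \<open>Positivity of \<open>t\<close> permits passing to \<open>ln t\<close>; the convergence
  obtained there makes \<open>lim\<close> in \<open>natural_density\<close> a genuine limit.\<close>

lemma LIMSEQ_A_density:
  assumes "t > 0"
  shows "(\<lambda>N. real (count_upto (\<lambda>n. abundancy n \<ge> t) N) / real N) \<longlonglongrightarrow> A_density t"
proof -
  have "count_upto (\<lambda>n. ln (abundancy n) \<ge> ln t) N = count_upto (\<lambda>n. abundancy n \<ge> t) N" for N
    unfolding count_upto_def
  proof (intro arg_cong[of _ _ card] Collect_cong conj_cong refl)
    fix n :: nat assume "1 \<le> n"
    then show "ln (abundancy n) \<ge> ln t \<longleftrightarrow> abundancy n \<ge> t"
      using assms abundancy_ge_1[of n] by simp
  qed
  then have "convergent (\<lambda>N. real (count_upto (\<lambda>n. abundancy n \<ge> t) N) / real N)"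
    using abundancy.convergent_density[of "ln t"] by simp
  then show ?thesis
    by (simp add: convergent_LIMSEQ_iff A_density_def natural_density_def count_upto_def abundancy_def)
qed

lemma LIMSEQ_B_density:
  assumes "t > 0"
  shows "(\<lambda>N. real (count_upto (\<lambda>n. totient_ratio n \<ge> t) N) / real N) \<longlonglongrightarrow> B_density t"
proof -
  have "count_upto (\<lambda>n. ln (totient_ratio n) \<ge> ln t) N = count_upto (\<lambda>n. totient_ratio n \<ge> t) N" for N
    unfolding count_upto_def
  proof (intro arg_cong[of _ _ card] Collect_cong conj_cong refl)
    fix n :: nat assume "1 \<le> n"
    then show "ln (totient_ratio n) \<ge> ln t \<longleftrightarrow> totient_ratio n \<ge> t"
      using assms totient_ratio_pos[of n] by simp
  qed
  then have "convergent (\<lambda>N. real (count_upto (\<lambda>n. totient_ratio n \<ge> t) N) / real N)"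
    using totient_ratio.convergent_density[of "ln t"] by simp
  then show ?thesis
    by (simp add: convergent_LIMSEQ_iff B_density_def natural_density_def count_upto_def totient_ratio_def)
qed

text \<open>The map \<open>n \<mapsto> n * a\<close> injects the integers counted up to
  \<open>N\<close> into those counted up to \<open>N * a\<close>; the limit of \<open>q\<close> is
  taken along this subsequence.\<close>

lemma density_scale_le:
  assumes a: "a > 0" "\<And>n. 1 \<le> n \<Longrightarrow> P n \<Longrightarrow> Q (n * a)"
    and p: "(\<lambda>N. real (count_upto P N) / real N) \<longlonglongrightarrow> p"
    and q: "(\<lambda>N. real (count_upto Q N) / real N) \<longlonglongrightarrow> q"
  shows "p \<le> real a * q"
proof -
  have "strict_mono (\<lambda>N. N * a)" using a(1) by (simp add: strict_mono_def)
  from LIMSEQ_subseq_LIMSEQ[OF q this]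
  have "(\<lambda>N. real a * (real (count_upto Q (N * a)) / real (N * a))) \<longlonglongrightarrow> real a * q"
    by (intro tendsto_mult tendsto_const) (simp add: o_def)
  moreover have "real (count_upto P N) / real N \<le> real a * (real (count_upto Q (N * a)) / real (N * a))" for N
    using count_upto_scale_le[of a P Q N, OF a] a(1) by (simp add: divide_right_mono)
  ultimately show ?thesis using p by (intro LIMSEQ_le) auto
qed

text \<open>All multiples of a single \<open>a\<close> with abundancy at least \<open>t\<close>
  qualify, so the density is at least \<open>1 / a\<close>.\<close>

lemma A_density_pos:
  assumes "t > 0"
  shows "A_density t > 0"
proof -
  obtain a where a: "a > 0" "abundancy a \<ge> t" using exists_abundancy_ge by blast
  have "(\<lambda>N. real (count_upto (\<lambda>_. True) N) / real N) \<longlonglongrightarrow> real (count_upto (\<lambda>_. True) 1) / real 1"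
    by (intro periodic_count_upto_LIMSEQ) auto
  moreover have "count_upto (\<lambda>_. True) 1 = 1"
    using count_upto_multiples[of 1 1] by simp
  ultimately have "(\<lambda>N. real (count_upto (\<lambda>_. True) N) / real N) \<longlonglongrightarrow> 1" by simp
  moreover have "abundancy (n * a) \<ge> t" if "1 \<le> n" for n
    using that a abundancy_dvd_mono[of a "n * a"] by simp
  ultimately have "1 \<le> real a * A_density t"
    by (intro density_scale_le[OF a(1) _ _ LIMSEQ_A_density[OF assms], of "\<lambda>_. True"])
  then have "0 < real a * A_density t" by linarith
  then show ?thesis using a(1) by (simp add: zero_less_mult_iff)
qed

lemma A_density_le_B_density:
  assumes "t > 0"
  shows "A_density t \<le> B_density t"
proof -
  have "A_density t \<le> real 1 * B_density t"
  proof (rule density_scale_le[OF _ _ LIMSEQ_A_density[OF assms] LIMSEQ_B_density[OF assms]])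
    fix n :: nat assume "1 \<le> n" "abundancy n \<ge> t"
    then show "totient_ratio (n * 1) \<ge> t" using abundancy_le_totient_ratio[of n] by simp
  qed simp
  then show ?thesis by simp
qed

section \<open>Asymptotic cost and loss of the multiplier; the second inequality\<close>

lemma ln4_bounds: "0 \<le> ln (4 :: real)" "ln (4 :: real) < 14 / 10"
proof -
  have "ln (4 :: real) = 2 * ln 2" using ln_realpow[of 2 2] by simp
  then show "0 \<le> ln (4 :: real)" "ln (4 :: real) < 14 / 10"
    using ln2_le_25_over_36 by auto
qed

lemma eventually_cost_less:
  "eventually (\<lambda>x :: real. (2 * x + x powr (2/3) * (4 * ln x)) * ln 4 < 3 * x) at_top"
proof -
  \<comment> \<open>A rational bound for \<open>ln 4\<close> suffices: the leading coefficient
    becomes 2.8, below 3.\<close>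
  have "eventually (\<lambda>x :: real. (2 * x + x powr (2/3) * (4 * ln x)) * (14/10) < 3 * x) at_top"
    by real_asymp
  then show ?thesis using eventually_gt_at_top[of 1]
  proof eventually_elim
    case (elim x)
    have "(2 * x + x powr (2/3) * (4 * ln x)) * ln 4 \<le> (2 * x + x powr (2/3) * (4 * ln x)) * (14/10)"
      using elim ln4_bounds by (intro mult_left_mono) auto
    then show ?case using elim by linarith
  qed
qed

text \<open>Since \<open>ln (x^2) = 2 * ln x\<close>, the last summand contributes
  \<open>2 * ln 4 / x\<close>, below \<open>5 / x\<close>. The others are of lower order: the
  exponent 2/3 exceeds 1/2, while being less than 1 keeps the cost of the repeated primorial
  negligible.\<close>

lemma eventually_loss_less:
  "eventually (\<lambda>x :: real.
    ln (x\<^sup>2) * (1 / x\<^sup>2 + 1 / (x powr (2/3) - 1)\<^sup>2 + ln 4 / (x * ln x)) < 5 / x) at_top"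
proof -
  have "eventually (\<lambda>x :: real.
      ln (x\<^sup>2) * (1 / x\<^sup>2 + 1 / (x powr (2/3) - 1)\<^sup>2 + (14/10) / (x * ln x)) < 5 / x) at_top"
    by real_asymp
  then show ?thesis using eventually_gt_at_top[of 1]
  proof eventually_elim
    case (elim x)
    have "ln (x\<^sup>2) * (1 / x\<^sup>2 + 1 / (x powr (2/3) - 1)\<^sup>2 + ln 4 / (x * ln x))
        \<le> ln (x\<^sup>2) * (1 / x\<^sup>2 + 1 / (x powr (2/3) - 1)\<^sup>2 + (14/10) / (x * ln x))"
      using elim ln4_bounds by (intro add_mono mult_left_mono divide_right_mono order_refl) auto
    then show ?case using elim by linarith
  qed
qed

lemma exists_boosting_factor:
  assumes x: "x > 1" "x powr (2/3) > 2"
    and cost: "(2 * x + x powr (2/3) * (4 * ln x)) * ln 4 < 3 * x"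
  shows "\<exists>m>0. real m < exp (3 * x) \<and> (\<forall>n>0. abundancy (n * m)
    \<ge> totient_ratio n * (1 - (1 / x\<^sup>2 + 1 / (x powr (2/3) - 1)\<^sup>2 + ln 4 / (x * ln x))))"
proof -
  \<comment> \<open>\<open>w\<close> governs the leading terms of both size and loss.
    \<open>v\<close> and \<open>b\<close> make the small primes harmless at lower-order cost, with
    \<open>2 ^ (b + 1) \<ge> x^2\<close> because \<open>4 * ln 2 \<ge> 2\<close>.\<close>
  define w v b where "w = nat \<lfloor>2 * x\<rfloor>" and "v = nat \<lfloor>x powr (2/3)\<rfloor>" and "b = nat \<lfloor>4 * ln x\<rfloor>"
  define m where "m = primorial w * primorial v ^ b"
  have w: "real w \<le> 2 * x" "real w + 1 \<ge> 2 * x" using x unfolding w_def by linarith+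
  have v: "real v \<le> x powr (2/3)" "real v \<ge> x powr (2/3) - 1" using x unfolding v_def by linarith+
  have lx: "ln x > 0" using x by simp
  then have b: "real b \<le> 4 * ln x" "real b + 1 \<ge> 4 * ln x" unfolding b_def by linarith+
  have "x powr (2/3) \<le> x powr 1" using x by (intro powr_mono) auto
  then have vw: "v \<le> w" using x unfolding v_def w_def by (intro nat_mono floor_mono) auto
  have v1: "v \<ge> 1" using v x by linarith
  have "m \<le> 4 ^ w * (4 ^ v) ^ b"
    unfolding m_def by (intro mult_le_mono power_mono primorial_le) auto
  then have "real m \<le> real (4 ^ w * (4 ^ v) ^ b)" by (rule of_nat_mono)
  also have "\<dots> = 4 ^ (w + v * b)" by (simp add: power_add power_mult)
  also have "\<dots> = 4 powr real (w + v * b)" by (rule powr_realpow[symmetric]) simp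
  also have "\<dots> = exp ((real w + real v * real b) * ln 4)" by (simp add: powr_def)
  also have "\<dots> \<le> exp ((2 * x + x powr (2/3) * (4 * ln x)) * ln 4)"
  proof -
    have "real v * real b \<le> x powr (2/3) * (4 * ln x)"
      by (rule mult_mono[OF v(1) b(1)]) simp_all
    then have "real w + real v * real b \<le> 2 * x + x powr (2/3) * (4 * ln x)"
      using w(1) by linarith
    then show ?thesis unfolding exp_le_cancel_iff using ln4_bounds(1) by (rule mult_right_mono)
  qed
  also have "\<dots> < exp (3 * x)" using cost by simp
  finally have "real m < exp (3 * x)" .
  moreover have "abundancy (n * m)
    \<ge> totient_ratio n * (1 - (1 / x\<^sup>2 + 1 / (x powr (2/3) - 1)\<^sup>2 + ln 4 / (x * ln x)))" if n: "n > 0" for n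
  proof -
    have "x\<^sup>2 = exp (2 * ln x)" using x by (simp add: exp_double)
    also have "\<dots> \<le> exp ((4 * ln x) * ln 2)"
      using mult_left_mono[of "1/2" "ln (2::real)" "4 * ln x"] lx ln2_ge_two_thirds by simp
    also have "\<dots> \<le> exp ((real b + 1) * ln 2)" using b by (simp add: mult_right_mono)
    also have "\<dots> = 2 powr real (b + 1)" by (simp add: powr_def add.commute)
    also have "\<dots> = 2 ^ (b + 1)" by (rule powr_realpow) simp
    finally have "1 / 2 ^ (b + 1) \<le> 1 / x\<^sup>2" using x by (intro divide_left_mono) auto
    moreover have "1 / (real v)\<^sup>2 \<le> 1 / (x powr (2/3) - 1)\<^sup>2"
      using v v1 x by (intro divide_left_mono power_mono) auto
    moreover have "2 * ln 4 / ((real w + 1) * ln (real w + 1)) \<le> ln 4 / (x * ln x)"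
    proof -
      have "ln x \<le> ln (real w + 1)" using w(2) x(1) by (subst ln_le_cancel_iff) linarith+
      then have "(2 * x) * ln x \<le> (real w + 1) * ln (real w + 1)"
        using w(2) lx x(1) by (intro mult_mono) linarith+
      moreover have "(2 * x) * ln x > 0" using lx x(1) by simp
      ultimately have "2 * ln 4 / ((real w + 1) * ln (real w + 1)) \<le> 2 * ln 4 / ((2 * x) * ln x)"
        using ln4_bounds(1) by (intro frac_le) auto
      also have "\<dots> = ln 4 / (x * ln x)" by simp
      finally show ?thesis .
    qed
    ultimately have "1 / 2 ^ (b + 1) + 1 / (real v)\<^sup>2 + 2 * ln 4 / ((real w + 1) * ln (real w + 1))
        \<le> 1 / x\<^sup>2 + 1 / (x powr (2/3) - 1)\<^sup>2 + ln 4 / (x * ln x)" by (intro add_mono)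
    then have "totient_ratio n * (1 - (1 / x\<^sup>2 + 1 / (x powr (2/3) - 1)\<^sup>2 + ln 4 / (x * ln x)))
        \<le> totient_ratio n * (1 - (1 / 2 ^ (b + 1) + 1 / (real v)\<^sup>2 + 2 * ln 4 / ((real w + 1) * ln (real w + 1))))"
      using totient_ratio_pos[OF n] by (intro mult_left_mono) auto
    also have "\<dots> \<le> abundancy (n * m)"
      unfolding m_def by (rule abundancy_mult_primorial_ge[OF n v1 vw])
    finally show ?thesis .
  qed
  moreover have "m > 0" by (simp add: m_def primorial_pos)
  ultimately show ?thesis by blast
qed

text \<open>Stated in the parameter \<open>x = sqrt y\<close>, for which
  \<open>t = exp euler_mascheroni * ln (x^2)\<close>. Multiplication by the boosting factor
  \<open>m\<close> sends integers counted by \<open>B_density\<close> at \<open>t\<close> to ones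
  counted by \<open>A_density\<close> at the shifted argument.\<close>

lemma B_density_less:
  "eventually (\<lambda>x :: real. B_density (exp euler_mascheroni * ln (x\<^sup>2))
    < exp (3 * x) * A_density (exp euler_mascheroni * ln (x\<^sup>2) - 5 * exp euler_mascheroni / x)) at_top"
proof -
  have "eventually (\<lambda>x :: real. x powr (2/3) > 2) at_top"
    and "eventually (\<lambda>x :: real. ln (x\<^sup>2) > 5 / x) at_top" by real_asymp+
  then show ?thesis using eventually_gt_at_top[of 1] eventually_cost_less eventually_loss_less
  proof eventually_elim
    case (elim x)
    define g where "g = exp (euler_mascheroni :: real)"
    define t t' where "t = g * ln (x\<^sup>2)" and "t' = t - 5 * g / x"
    define E where "E = 1 / x\<^sup>2 + 1 / (x powr (2/3) - 1)\<^sup>2 + ln 4 / (x * ln x)"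
    have g: "g > 0" by (simp add: g_def)
    have L: "ln (x\<^sup>2) > 0" using elim(2,3) by (meson less_trans divide_pos_pos zero_less_numeral zero_less_one)
    have "t' = g * (ln (x\<^sup>2) - 5 / x)" by (simp add: t'_def t_def algebra_simps)
    then have t': "t' > 0" using g elim(2) by simp
    have t: "t > 0" using g L by (simp add: t_def)
    \<comment> \<open>The loss is below \<open>5 / x\<close>, which is below
      \<open>ln (x^2)\<close>; hence \<open>E < 1\<close>, and multiplying by \<open>1 - E\<close>
      preserves inequalities.\<close>
    have "ln (x\<^sup>2) * E < ln (x\<^sup>2) * 1" using elim(2,5) by (simp add: E_def)
    then have E: "E < 1" using L by (simp only: mult_less_cancel_left_pos)
    have "g * (ln (x\<^sup>2) * E) \<le> g * (5 / x)"
      using g elim(5) by (intro mult_left_mono) (auto simp: E_def)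
    then have tE: "t' \<le> t * (1 - E)" by (simp add: t'_def t_def algebra_simps)
    obtain m where m: "m > 0" "real m < exp (3 * x)"
      "\<And>n. n > 0 \<Longrightarrow> abundancy (n * m) \<ge> totient_ratio n * (1 - E)"
      using exists_boosting_factor[OF elim(3,1,4)] unfolding E_def by blast
    have "B_density t \<le> real m * A_density t'"
    proof (rule density_scale_le[OF m(1) _ LIMSEQ_B_density[OF t] LIMSEQ_A_density[OF t']])
      fix n :: nat assume n: "1 \<le> n" "totient_ratio n \<ge> t"
      then have "t * (1 - E) \<le> totient_ratio n * (1 - E)" using E by (intro mult_right_mono) auto
      then show "abundancy (n * m) \<ge> t'" using tE m(3)[of n] n(1) by linarith
    qed
    \<comment> \<open>Strictness comes from \<open>m < exp (3 * x)\<close> together with positivity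
      of the density.\<close>
    also have "\<dots> < exp (3 * x) * A_density t'"
      using m(2) A_density_pos[OF t'] by (rule mult_strict_right_mono)
    finally show ?case by (simp add: t'_def t_def g_def)
  qed
qed

theorem theorem3:
  "\<exists>t\<^sub>0::real. \<forall>t\<ge>t\<^sub>0.
     (let y = exp (t * exp (- euler_mascheroni)) in
       A_density t \<le> B_density t \<and>
       B_density t < exp (3 * sqrt y) * A_density (t - 5 * exp euler_mascheroni / sqrt y))"
proof -
  \<comment> \<open>Since \<open>sqrt y\<close> tends to infinity with \<open>t\<close>, the
    eventual inequality in \<open>x\<close> can be pulled back along
    \<open>x = sqrt y\<close>.\<close>
  have "filterlim (\<lambda>t. sqrt (exp (t * exp (- euler_mascheroni)))) at_top at_top"
    by real_asymp
  from eventually_compose_filterlim[OF B_density_less this]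
  have "eventually (\<lambda>t. let y = exp (t * exp (- euler_mascheroni)) in
       A_density t \<le> B_density t \<and>
       B_density t < exp (3 * sqrt y) * A_density (t - 5 * exp euler_mascheroni / sqrt y)) at_top"
    using eventually_gt_at_top[of 0]
  proof eventually_elim
    case (elim t)
    have "exp euler_mascheroni * ln ((sqrt (exp (t * exp (- euler_mascheroni))))\<^sup>2) = t"
      by (simp add: exp_minus)
    with elim(1) show ?case using A_density_le_B_density[OF elim(2)] by (simp only: Let_def)
  qed
  then show ?thesis by (simp add: eventually_at_top_linorder)
qed

end
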